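(* Let $n\ge 2$ and let $d\in\mathbb{R}^{n\times n}$ be symmetric with zero diagonal and positive off-diagonal entries, of strict negative type. Then the certified peeling algorithm (described in the context, run in exact arithmetic) on input $d$ terminates after finitely many linear solves and returns $p_*$ exactly, where $p_*$ is the unique maximizer of $q(p)=p^Tdp$ over $\Delta_{n-1}$. Moreover: every working set $\mathcal{J}$ has $|\mathcal{J}|\ge 2$; from the exit of Phase I onward, $p\in\Delta_{n-1}$; each Phase III inner loop performs at most $n-1$ solves; and the values $c=q(p)$ observed at successive Phase II checks strictly increase.
   Context: Write $[n]=\{1,\dots,n\}$ and $1$ for the all-ones vector. The matrix $d$ is of strict negative type if $v^Tdv<0$ for every $v\neq 0$ with $1^Tv=0$ (no triangle inequality is assumed). $\Delta_{n-1}=\{p\in[0,1]^n:1^Tp=1\}$. For $\mathcal{J}\subseteq[n]$ with $|\mathcal{J}|\ge2$, let $d_{\mathcal{J},\mathcal{J}}$ be the principal submatrix (invertible when $d$ is of strict negative type), $1_{\mathcal{J}}$ the all-ones vector on $\mathcal{J}$, $w_{\mathcal{J}}=d_{\mathcal{J},\mathcal{J}}^{-1}1_{\mathcal{J}}$, and let $p^{\mathcal{J}}\in\mathbb{R}^n$ be the vector equal to $w_{\mathcal{J}}/(1_{\mathcal{J}}^Tw_{\mathcal{J}})$ on $\mathcal{J}$ and $0$ off $\mathcal{J}$ (entries may be negative). Computing one $p^{\mathcal{J}}$ is one linear solve. $\operatorname{supp}(p)=\{j:p_j\ne0\}$. Certified peeling algorithm. (Phase I) Set $\mathcal{J}\leftarrow[n]$,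 $p\leftarrow p^{\mathcal{J}}$. While $\min_jp_j<0$: set $\mathcal{J}\leftarrow\{j:p_j>0\}$, $p\leftarrow p^{\mathcal{J}}$. Then set $g\leftarrow dp$, $c\leftarrow p^Tg$, $k\leftarrow\arg\max_jg_j$. (Phase II) A check is an evaluation of the predicate $g_k>c$. While $g_k>c$, do the following: (Phase III) set $\mathcal{J}\leftarrow\operatorname{supp}(p)\cup\{k\}$, $y\leftarrow p^{\mathcal{J}}$; inner loop: while $\min_{j\in\mathcal{J}}y_j<0$, set $t\leftarrow\min\{p_i/(p_i-y_i):y_i<0\}$, $p\leftarrow p+t(y-p)$, $\mathcal{J}\leftarrow\{j:p_j>0\}$, $y\leftarrow p^{\mathcal{J}}$. The solves of the inner loop include the one forming the initial $y$ on entry. After the inner loop set $p\leftarrow y$, $g\leftarrow dp$, $c\leftarrow p^Tg$, $k\leftarrow\arg\max_jg_j$. When $g_k\le c$, return $p$. *)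

theory Defs
  imports "HOL-Analysis.Analysis"
begin

text \<open>
  The index set \<open>[n]\<close> is a finite type \<open>'n\<close> with \<open>n = CARD('n)\<close>.
\<close>

definition strict_negative_type :: "real^'n^'n \<Rightarrow> bool" where
  "strict_negative_type d \<longleftrightarrow>
     (\<forall>v. v \<noteq> 0 \<and> 1 \<bullet> v = 0 \<longrightarrow> v \<bullet> (d *v v) < 0)"

definition prob_simplex :: "(real^'n) set" where
  "prob_simplex = {p. (\<forall>j. 0 \<le> p $ j \<and> p $ j \<le> 1) \<and> 1 \<bullet> p = 1}"

definition quad :: "real^'n^'n \<Rightarrow> real^'n \<Rightarrow> real" where
  "quad d p = p \<bullet> (d *v p)"

definition supp :: "real^'n \<Rightarrow> 'n set" where
  "supp p = {j. p $ j \<noteq> 0}"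

definition ones_on :: "'n set \<Rightarrow> real^'n" where
  "ones_on J = (\<chi> j. if j \<in> J then 1 else 0)"

text \<open>
  The type of a matrix fixes its size, so the principal submatrix \<open>d\<^sub>J\<^sub>J\<close> is represented by the
  full-size block matrix \<open>d\<^sub>J\<^sub>J \<oplus> I\<close>, with the identity block on the complement of \<open>J\<close>. It is
  invertible iff \<open>d\<^sub>J\<^sub>J\<close> is, and then its inverse is \<open>d\<^sub>J\<^sub>J\<^sup>-\<^sup>1 \<oplus> I\<close>; applied to \<open>ones_on J\<close>
  this gives \<open>w\<^sub>J\<close> extended by zero off \<open>J\<close> (see \<open>wvec_solves\<close>).
\<close>

definition principal :: "real^'n^'n \<Rightarrow> 'n set \<Rightarrow> real^'n^'n" where
  "principal d J =
     (\<chi> i j. if i \<in> J \<and> j \<in> J then d $ i $ j else if i = j then 1 else 0)"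

definition wvec :: "real^'n^'n \<Rightarrow> 'n set \<Rightarrow> real^'n" where
  "wvec d J = matrix_inv (principal d J) *v ones_on J"

definition pvec :: "real^'n^'n \<Rightarrow> 'n set \<Rightarrow> real^'n" where
  "pvec d J = (\<chi> j. if j \<in> J then wvec d J $ j / (\<Sum>i\<in>J. wvec d J $ i) else 0)"

lemma wvec_solves:
  fixes d :: "real^'n^'n"
  assumes "invertible (principal d J)"
  shows "i \<in> J \<Longrightarrow> (\<Sum>j\<in>J. d $ i $ j * wvec d J $ j) = 1"
    and "i \<notin> J \<Longrightarrow> wvec d J $ i = 0"
proof -
  have "principal d J ** matrix_inv (principal d J) = mat 1"
    using assms unfolding invertible_def matrix_inv_def
    by (rule someI2_ex) simp
  then have "principal d J *v wvec d J = ones_on J"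
    unfolding wvec_def by (simp add: matrix_vector_mul_assoc)
  then have *: "(\<Sum>j\<in>UNIV. principal d J $ i $ j * wvec d J $ j) = ones_on J $ i" for i
    by (simp add: matrix_vector_mult_def vec_eq_iff)
  show "(\<Sum>j\<in>J. d $ i $ j * wvec d J $ j) = 1" if "i \<in> J"
  proof -
    have "(\<Sum>j\<in>J. d $ i $ j * wvec d J $ j)
        = (\<Sum>j\<in>UNIV. principal d J $ i $ j * wvec d J $ j)"
      using that by (intro sum.mono_neutral_cong_left) (auto simp: principal_def)
    then show ?thesis
      using that by (simp add: * ones_on_def)
  qed
  show "wvec d J $ i = 0" if "i \<notin> J"
  proof -
    have "(\<Sum>j\<in>UNIV. principal d J $ i $ j * wvec d J $ j)
        = (\<Sum>j\<in>{i}. wvec d J $ j)"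
      using that by (intro sum.mono_neutral_cong_right) (auto simp: principal_def)
    then show ?thesis
      using that by (simp add: * ones_on_def)
  qed
qed

text \<open>
  The algorithm is a transition system. Ties in \<open>arg max\<close> may be broken arbitrarily, so the
  transition relation is nondeterministic. States:
  \<^item> \<open>PhaseI J p\<close>: at the loop test of Phase I;
  \<^item> \<open>Check p g c k\<close>: at a Phase II check of \<open>g\<^sub>k > c\<close>;
  \<^item> \<open>Inner p J y s\<close>: at the loop test of a Phase III inner loop, where \<open>s\<close> counts the solves made
    by this inner loop so far, including the one forming the initial \<open>y\<close>;
  \<^item> \<open>Return p\<close>: \<open>p\<close> has been returned.

  Starting the algorithm takes one solve, and each transition takes at most one.
\<close>

datatype 'n peel_state =
    PhaseI "'n set" "real^'n"
  | Check "real^'n" "real^'n" real 'n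
  | Inner "real^'n" "'n set" "real^'n" nat
  | Return "real^'n"

definition peel_init :: "real^'n^'n \<Rightarrow> 'n peel_state" where
  "peel_init d = PhaseI UNIV (pvec d UNIV)"

inductive peel_step :: "real^'n^'n \<Rightarrow> 'n peel_state \<Rightarrow> 'n peel_state \<Rightarrow> bool"
  for d :: "real^'n^'n" where
  phaseI_loop:
    "(MIN j. p $ j) < 0 \<Longrightarrow> J' = {j. p $ j > 0}
     \<Longrightarrow> peel_step d (PhaseI J p) (PhaseI J' (pvec d J'))"
| phaseI_exit:
    "\<not> (MIN j. p $ j) < 0 \<Longrightarrow> g = d *v p \<Longrightarrow> c = p \<bullet> g
     \<Longrightarrow> is_arg_max (\<lambda>j. g $ j) (\<lambda>_. True) k
     \<Longrightarrow> peel_step d (PhaseI J p) (Check p g c k)"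
| check_return:
    "\<not> g $ k > c \<Longrightarrow> peel_step d (Check p g c k) (Return p)"
| check_enter:
    "g $ k > c \<Longrightarrow> J = supp p \<union> {k}
     \<Longrightarrow> peel_step d (Check p g c k) (Inner p J (pvec d J) 1)"
| inner_loop:
    "(MIN j\<in>J. y $ j) < 0
     \<Longrightarrow> t = Min {p $ i / (p $ i - y $ i) | i. y $ i < 0}
     \<Longrightarrow> p' = p + t *\<^sub>R (y - p) \<Longrightarrow> J' = {j. p' $ j > 0}
     \<Longrightarrow> peel_step d (Inner p J y s) (Inner p' J' (pvec d J') (Suc s))"
| inner_exit:
    "\<not> (MIN j\<in>J. y $ j) < 0 \<Longrightarrow> g = d *v y \<Longrightarrow> c = y \<bullet> g
     \<Longrightarrow> is_arg_max (\<lambda>j. g $ j) (\<lambda>_. True) k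
     \<Longrightarrow> peel_step d (Inner p J y s) (Check y g c k)"

definition peel_reachable :: "real^'n^'n \<Rightarrow> 'n peel_state \<Rightarrow> bool" where
  "peel_reachable d S \<longleftrightarrow> (peel_step d)\<^sup>*\<^sup>* (peel_init d) S"

definition peel_terminates :: "real^'n^'n \<Rightarrow> bool" where
  "peel_terminates d \<longleftrightarrow>
     \<not> (\<exists>S :: nat \<Rightarrow> 'n peel_state. S 0 = peel_init d \<and> (\<forall>i. peel_step d (S i) (S (Suc i))))"

end

theory Submission
  imports Defs
begin

text \<open>
  On the hyperplane \<open>1 \<bullet> p = 1\<close> the form \<open>quad d\<close> is strictly concave, and \<open>pvec d J\<close> is its unique
  maximizer among the vectors supported in \<open>J\<close>; there the gradient \<open>d *v p\<close> is constant on \<open>J\<close>.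
  Hence \<open>quad d u = quad d p + quad d (u - p)\<close> for \<open>p = pvec d J\<close>, so moving towards \<open>pvec d J\<close>
  increases \<open>quad d\<close>. If \<open>g $ k > c\<close>, the new target \<open>y\<close> has \<open>y $ k > 0\<close>, so that the first inner step
  has positive length and strictly increases \<open>quad d\<close>. Since the values at the checks are among the
  finitely many numbers \<open>quad d (pvec d J)\<close>, the algorithm terminates. A point with \<open>g $ k \<le> c\<close>
  satisfies the first-order optimality condition on the simplex.
\<close>

section \<open>Coordinate sums, supports and largest entries\<close>

lemma one_inner_sum: "(1::real^'n) \<bullet> v = (\<Sum>i\<in>UNIV. v $ i)"
  by (simp add: inner_vec_def)

lemma prob_simplexI:
  fixes p :: "real^'n"
  assumes "\<And>j. 0 \<le> p $ j" "1 \<bullet> p = 1"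
  shows "p \<in> prob_simplex"
proof -
  have "p $ j \<le> 1" for j
    using assms member_le_sum[of j UNIV "($) p"] by (simp add: one_inner_sum)
  then show ?thesis using assms by (simp add: prob_simplex_def)
qed

lemma inner_const_on:
  fixes v g :: "real^'n"
  assumes "supp v \<subseteq> J" "\<And>i. i \<in> J \<Longrightarrow> g $ i = c"
  shows "v \<bullet> g = c * (1 \<bullet> v)"
proof -
  have "v $ i * g $ i = c * v $ i" for i
    using assms by (cases "v $ i = 0") (auto simp: supp_def)
  then show ?thesis by (simp only: inner_vec_def inner_real_def sum_distrib_left) simp
qed

lemma supp_diff: "supp (u - v) \<subseteq> supp u \<union> supp v"
  by (auto simp: supp_def)

lemma arg_max_exists: "\<exists>k. is_arg_max (\<lambda>j. (g::real^'n) $ j) (\<lambda>_. True) k"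
proof -
  have "Max (range (($) g)) \<in> range (($) g)" by (intro Max_in) auto
  then obtain k where "g $ k = Max (range (($) g))" by (metis imageE)
  then have "g $ j \<le> g $ k" for j by simp
  then show ?thesis by (auto simp: is_arg_max_def not_less)
qed

lemma quad_scaleR: "quad d (r *\<^sub>R x) = r\<^sup>2 * quad d x"
  by (simp add: quad_def matrix_vector_mult_scaleR power2_eq_square)

section \<open>Strict concavity and positive values of the form\<close>

locale distance_matrix =
  fixes d :: "real^'n^'n"
  assumes sym: "transpose d = d"
    and diag: "\<And>i. d $ i $ i = 0"
    and pos: "\<And>i j. i \<noteq> j \<Longrightarrow> d $ i $ j > 0"
    and neg: "strict_negative_type d"
begin

lemma bilinear_sym: "x \<bullet> (d *v y) = y \<bullet> (d *v x)"
  by (metis dot_lmul_matrix inner_commute sym transpose_matrix_vector)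

lemma quad_expand: "quad d u = quad d p + 2 * ((u - p) \<bullet> (d *v p)) + quad d (u - p)"
  using bilinear_sym[of p u]
  by (simp add: quad_def matrix_vector_mult_diff_distrib inner_diff_left inner_diff_right)

lemma quad_neg: "1 \<bullet> v = 0 \<Longrightarrow> v \<noteq> 0 \<Longrightarrow> quad d v < 0"
  using neg by (simp add: strict_negative_type_def quad_def)

lemma quad_nonpos: "1 \<bullet> v = 0 \<Longrightarrow> quad d v \<le> 0"
  using quad_neg[of v] by (cases "v = 0") (auto simp: quad_def)

text \<open>The diagonal vanishes, so a nonzero term of the double sum involves two distinct support
  indices. Positivity of \<open>quad d p\<close> thus bounds the Phase III working sets from
  below.\<close>

lemma quad_nonzero_card:
  assumes "quad d p \<noteq> 0"
  shows "2 \<le> card (supp p)"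
proof -
  have "quad d p = (\<Sum>i\<in>UNIV. \<Sum>j\<in>UNIV. p $ i * (d $ i $ j * p $ j))"
    by (simp add: quad_def inner_vec_def matrix_vector_mult_def sum_distrib_left)
  with assms obtain i j where "p $ i * (d $ i $ j * p $ j) \<noteq> 0"
    by (metis (no_types, lifting) sum.neutral)
  then have "i \<noteq> j" "{i, j} \<subseteq> supp p" using diag by (auto simp: supp_def)
  then show ?thesis by (metis card_2_iff card_mono finite)
qed

text \<open>The midpoint of two vertices in \<open>J\<close> works: only off-diagonal entries
  contribute.\<close>

lemma exists_quad_pos:
  assumes "2 \<le> card J"
  shows "\<exists>u. supp u \<subseteq> J \<and> 1 \<bullet> u = 1 \<and> 0 < quad d u"
proof -
  obtain i j where ij: "i \<in> J" "j \<in> J" "i \<noteq> j"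
    using assms by (metis card_2_iff' card_le_Suc0_iff_eq finite not_less_eq_eq numeral_2_eq_2)
  define e :: "real^'n" where "e = axis i 1 + axis j 1"
  have "quad d e = d $ i $ j + d $ j $ i"
    by (simp add: quad_def e_def matrix_vector_right_distrib inner_add_left inner_add_right
        inner_axis' matrix_vector_mult_basis column_def diag)
  moreover have "1 \<bullet> e = 2" by (simp add: e_def inner_add_right inner_axis)
  moreover have "supp e \<subseteq> J" using ij by (auto simp: e_def supp_def axis_def split: if_splits)
  ultimately have "supp ((1/2) *\<^sub>R e) \<subseteq> J \<and> 1 \<bullet> ((1/2) *\<^sub>R e) = 1 \<and> 0 < quad d ((1/2) *\<^sub>R e)"
    using pos[of i j] pos[of j i] ij by (auto simp: quad_scaleR supp_def)
  then show ?thesis by blast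
qed

section \<open>Points with constant gradient on \<open>J\<close>\<close>

lemma stationary_quad:
  assumes "supp x \<subseteq> J" "1 \<bullet> x = 1" "\<And>i. i \<in> J \<Longrightarrow> (d *v x) $ i = c"
  shows "quad d x = c"
  using inner_const_on[OF assms(1,3)] assms(2) by (simp add: quad_def)

text \<open>\<open>u - x\<close> lives on \<open>J\<close> and has coordinate sum 0, so the linear
  term against a gradient constant on \<open>J\<close> vanishes.\<close>

lemma stationary_expand:
  assumes "supp x \<subseteq> J" "1 \<bullet> x = 1" "\<And>i. i \<in> J \<Longrightarrow> (d *v x) $ i = c"
    and "supp u \<subseteq> J" "1 \<bullet> u = 1"
  shows "quad d u = c + quad d (u - x)"
proof -
  have "supp (u - x) \<subseteq> J" using supp_diff[of u x] assms by auto
  from inner_const_on[OF this assms(3)] show ?thesis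
    using quad_expand[of u x] stationary_quad[OF assms(1-3)] assms by (simp add: inner_diff_right)
qed

lemma stationary_pos:
  assumes "2 \<le> card J" "supp x \<subseteq> J" "1 \<bullet> x = 1" "\<And>i. i \<in> J \<Longrightarrow> (d *v x) $ i = c"
  shows "0 < c"
proof -
  obtain u where u: "supp u \<subseteq> J" "1 \<bullet> u = 1" "0 < quad d u"
    using exists_quad_pos[OF assms(1)] by blast
  moreover have "quad d (u - x) \<le> 0"
    by (rule quad_nonpos) (simp add: inner_diff_right u assms)
  ultimately show ?thesis using stationary_expand[OF assms(2-4) u(1,2)] by simp
qed

section \<open>The linear systems and their normalized solutions\<close>

lemma sum_supp: "supp v \<subseteq> J \<Longrightarrow> (\<Sum>j\<in>J. f j * v $ j) = (\<Sum>j\<in>UNIV. f j * (v $ j :: real))"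
  by (intro sum.mono_neutral_left) (auto simp: supp_def)

text \<open>The identity block makes a kernel vector vanish off \<open>J\<close>. With nonzero sum,
  it could be rescaled to a stationary point of value 0, against \<open>stationary_pos\<close>; with
  sum 0, strict negative type makes it zero.\<close>

lemma invertible_principal:
  assumes "2 \<le> card J"
  shows "invertible (principal d J)"
proof -
  have "v = 0" if v: "principal d J *v v = 0" for v
  proof -
    have *: "(\<Sum>j\<in>UNIV. principal d J $ i $ j * v $ j) = 0" for i
      using v by (simp add: matrix_vector_mult_def vec_eq_iff)
    have "v $ i = 0" if "i \<notin> J" for i
    proof -
      have "(\<Sum>j\<in>UNIV. principal d J $ i $ j * v $ j) = (\<Sum>j\<in>{i}. v $ j)"
        using that by (intro sum.mono_neutral_cong_right) (auto simp: principal_def)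
      then show ?thesis by (simp add: *)
    qed
    then have supp: "supp v \<subseteq> J" by (auto simp: supp_def)
    have zero: "(d *v v) $ i = 0" if "i \<in> J" for i
    proof -
      have "(\<Sum>j\<in>J. d $ i $ j * v $ j) = (\<Sum>j\<in>UNIV. principal d J $ i $ j * v $ j)"
        using that supp by (intro sum.mono_neutral_cong_left) (auto simp: principal_def)
      then show ?thesis using sum_supp[OF supp] by (simp add: * matrix_vector_mult_def)
    qed
    have "1 \<bullet> v = 0"
    proof (rule ccontr)
      assume "1 \<bullet> v \<noteq> 0"
      moreover define x where "x = (1 / (1 \<bullet> v)) *\<^sub>R v"
      ultimately have "supp x \<subseteq> J" "1 \<bullet> x = 1" "\<And>i. i \<in> J \<Longrightarrow> (d *v x) $ i = 0"
        using supp zero by (auto simp: supp_def matrix_vector_mult_scaleR)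
      from stationary_pos[OF assms this] show False by simp
    qed
    moreover have "quad d v = 0" using inner_const_on[OF supp zero] by (simp add: quad_def)
    ultimately show ?thesis using quad_neg by fastforce
  qed
  then show ?thesis by (simp add: invertible_left_inverse matrix_left_invertible_ker)
qed

text \<open>The normalization is legitimate: \<open>d *v wvec d J\<close> is 1 on \<open>J\<close>,
  so \<open>quad d (wvec d J)\<close> equals the coordinate sum \<open>s\<close>. If
  \<open>s = 0\<close>, strict negative type gives \<open>wvec d J = 0\<close>, contradicting the
  value 1.\<close>

lemma
  assumes J: "2 \<le> card J"
  shows supp_pvec: "supp (pvec d J) \<subseteq> J"
    and sum_pvec: "1 \<bullet> pvec d J = 1"
    and gradient_pvec: "\<And>i. i \<in> J \<Longrightarrow> (d *v pvec d J) $ i = quad d (pvec d J)"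
proof -
  note w = wvec_solves[OF invertible_principal[OF J]]
  have supp_w: "supp (wvec d J) \<subseteq> J" using w(2) by (auto simp: supp_def)
  have dw: "(d *v wvec d J) $ i = 1" if "i \<in> J" for i
    using w(1)[OF that] sum_supp[OF supp_w] by (simp add: matrix_vector_mult_def)
  define s where "s = 1 \<bullet> wvec d J"
  have s: "s = (\<Sum>i\<in>J. wvec d J $ i)"
    using sum_supp[OF supp_w, of "\<lambda>_. 1"] by (simp add: s_def one_inner_sum)
  have "s \<noteq> 0"
  proof
    assume "s = 0"
    moreover have "quad d (wvec d J) = s"
      using inner_const_on[OF supp_w dw] by (simp add: quad_def s_def)
    ultimately have "wvec d J = 0" using quad_neg[of "wvec d J"] s_def by fastforce
    moreover have "J \<noteq> {}" using J by auto
    ultimately show False using dw by fastforce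
  qed
  have eq: "pvec d J = (1 / s) *\<^sub>R wvec d J"
    using w(2) by (auto simp: pvec_def vec_eq_iff s)
  show 1: "supp (pvec d J) \<subseteq> J" by (auto simp: supp_def pvec_def)
  show 2: "1 \<bullet> pvec d J = 1" using \<open>s \<noteq> 0\<close> by (simp add: eq flip: s_def)
  have 3: "(d *v pvec d J) $ i = 1 / s" if "i \<in> J" for i
    using dw[OF that] by (simp add: eq matrix_vector_mult_scaleR)
  show "\<And>i. i \<in> J \<Longrightarrow> (d *v pvec d J) $ i = quad d (pvec d J)"
    using stationary_quad[OF 1 2 3] 3 by simp
qed

lemma pvec_outside: "i \<notin> J \<Longrightarrow> pvec d J $ i = 0"
  by (simp add: pvec_def)

lemma quad_pvec_pos: "2 \<le> card J \<Longrightarrow> 0 < quad d (pvec d J)"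
  by (rule stationary_pos[OF _ supp_pvec sum_pvec gradient_pvec])

lemma quad_pvec_expand:
  assumes "2 \<le> card J" "supp u \<subseteq> J" "1 \<bullet> u = 1"
  shows "quad d u = quad d (pvec d J) + quad d (u - pvec d J)"
  using assms stationary_expand[OF supp_pvec sum_pvec gradient_pvec] by blast

lemma quad_pvec_max:
  assumes "2 \<le> card J" "supp u \<subseteq> J" "1 \<bullet> u = 1"
  shows "quad d u \<le> quad d (pvec d J)"
    and "u \<noteq> pvec d J \<Longrightarrow> quad d u < quad d (pvec d J)"
  using quad_pvec_expand[OF assms] quad_nonpos[of "u - pvec d J"] quad_neg[of "u - pvec d J"]
    sum_pvec[OF assms(1)] assms(3)
  by (auto simp: inner_diff_right)

text \<open>Sum 1 gives a positive coordinate \<open>j\<close>. The gradient at \<open>j\<close> is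
  the positive stationary value, so some term of that row is positive, and the zero diagonal puts it
  at a second index.\<close>

lemma card_pos_pvec:
  assumes "2 \<le> card J"
  shows "2 \<le> card {j. pvec d J $ j > 0}"
proof -
  let ?p = "pvec d J"
  have "\<exists>j. ?p $ j > 0"
    using sum_pvec[OF assms] sum_nonpos[of UNIV "($) ?p"] by (force simp: one_inner_sum not_less)
  then obtain j where j: "?p $ j > 0" by blast
  then have "j \<in> J" using pvec_outside by force
  then have "0 < (\<Sum>i\<in>UNIV. d $ j $ i * ?p $ i)"
    using gradient_pvec[OF assms] quad_pvec_pos[OF assms] by (simp add: matrix_vector_mult_def)
  then obtain i where i: "0 < d $ j $ i * ?p $ i"
    by (metis (no_types, lifting) not_less sum_nonpos)
  then have "i \<noteq> j" using diag by auto
  moreover have "?p $ i > 0" using i pos[of j i] \<open>i \<noteq> j\<close> by (simp add: zero_less_mult_iff)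
  ultimately have "card {i, j} \<le> card {j. ?p $ j > 0}" using j by (intro card_mono) auto
  then show ?thesis using \<open>i \<noteq> j\<close> by simp
qed

section \<open>Optimality on the simplex and the entering coordinate\<close>

lemma simplex_maximizer:
  assumes "p \<in> prob_simplex" "\<And>j. (d *v p) $ j \<le> quad d p"
    and "u \<in> prob_simplex" "u \<noteq> p"
  shows "quad d u < quad d p"
proof -
  have one: "1 \<bullet> u = 1" "1 \<bullet> p = 1" using assms by (auto simp: prob_simplex_def)
  have "u \<bullet> (d *v p) \<le> (\<Sum>j\<in>UNIV. u $ j * quad d p)"
    unfolding inner_vec_def inner_real_def
    using assms by (intro sum_mono mult_left_mono) (auto simp: prob_simplex_def)
  also have "\<dots> = quad d p" using one by (simp add: one_inner_sum flip: sum_distrib_right)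
  finally have "(u - p) \<bullet> (d *v p) \<le> 0" by (simp add: inner_diff_left quad_def)
  moreover have "quad d (u - p) < 0" using assms one by (intro quad_neg) (auto simp: inner_diff_right)
  ultimately show ?thesis using quad_expand[of u p] by simp
qed

text \<open>For the new target \<open>y\<close>, the negative number \<open>quad d (y - p)\<close>
  is the difference of \<open>(y - p) \<bullet> (d *v y)\<close> and
  \<open>(y - p) \<bullet> (d *v p)\<close>. The first vanishes by stationarity of \<open>y\<close>;
  the second is \<open>y $ k\<close> times the positive excess of the gradient at
  \<open>k\<close>.\<close>

lemma entering_coordinate_pos:
  assumes J: "2 \<le> card J" and p: "p = pvec d J"
    and k: "(d *v p) $ k > quad d p" and card: "2 \<le> card (supp p \<union> {k})"
  shows "pvec d (supp p \<union> {k}) $ k > 0" "p $ k = 0"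
proof -
  define y where "y = pvec d (supp p \<union> {k})"
  have one: "1 \<bullet> p = 1" "1 \<bullet> y = 1" using sum_pvec J card by (auto simp: p y_def)
  have supp: "supp p \<subseteq> J" using supp_pvec[OF J] p by simp
  have grad: "(d *v p) $ i = quad d p" if "i \<in> J" for i using gradient_pvec[OF J that] p by simp
  have "k \<notin> J" using grad k by fastforce
  then show "p $ k = 0" using supp by (auto simp: supp_def)
  have supp_y: "supp y \<subseteq> supp p \<union> {k}" using supp_pvec[OF card] by (simp add: y_def)
  have grad_y: "(d *v y) $ i = quad d y" if "i \<in> supp p \<union> {k}" for i
    using gradient_pvec[OF card that] by (simp add: y_def)
  have "y \<noteq> p" using grad_y[of k] k by auto
  then have "quad d (y - p) < 0" using one by (intro quad_neg) (auto simp: inner_diff_right)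
  moreover have "(y - p) \<bullet> (d *v y) = 0"
    using inner_const_on[of "y - p" "supp p \<union> {k}" "d *v y", OF _ grad_y]
      supp_diff[of y p] supp_y one
    by (auto simp: inner_diff_right)
  moreover have "y \<bullet> (d *v p) - quad d p = y $ k * ((d *v p) $ k - quad d p)"
  proof -
    have "y \<bullet> (d *v p) - quad d p = (\<Sum>i\<in>UNIV. y $ i * ((d *v p) $ i - quad d p))"
      using one(2)
      by (simp add: inner_vec_def right_diff_distrib sum_subtractf flip: sum_distrib_right)
    also have "\<dots> = (\<Sum>i\<in>{k}. y $ i * ((d *v p) $ i - quad d p))"
      using supp_y supp grad by (intro sum.mono_neutral_right) (auto simp: supp_def)
    finally show ?thesis by simp
  qed
  ultimately have "0 < y $ k * ((d *v p) $ k - quad d p)"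
    by (simp add: quad_def matrix_vector_mult_diff_distrib inner_diff_left inner_diff_right)
  then show "pvec d (supp p \<union> {k}) $ k > 0" using k by (simp add: zero_less_mult_iff y_def)
qed

section \<open>Invariant and termination measure\<close>

text \<open>In an inner loop \<open>card J + s\<close> never grows, which bounds the solves. The
  sign condition on \<open>y\<close> makes each step length positive.\<close>

fun inv_state :: "'n peel_state \<Rightarrow> bool" where
  "inv_state (PhaseI J p) \<longleftrightarrow> 2 \<le> card J \<and> p = pvec d J"
| "inv_state (Check p g c k) \<longleftrightarrow> p \<in> prob_simplex \<and> (\<exists>J. 2 \<le> card J \<and> p = pvec d J)
     \<and> g = d *v p \<and> c = quad d p \<and> (\<forall>j. g $ j \<le> g $ k)"
| "inv_state (Inner p J y s) \<longleftrightarrow> p \<in> prob_simplex \<and> supp p \<subseteq> J \<and> 2 \<le> card J \<and> y = pvec d J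
     \<and> (\<forall>i. y $ i < 0 \<longrightarrow> 0 < p $ i) \<and> 0 < quad d p \<and> 1 \<le> s \<and> card J + s \<le> CARD('n) + 1
     \<and> (s = 1 \<longrightarrow> quad d p < quad d y)"
| "inv_state (Return p) \<longleftrightarrow> p \<in> prob_simplex
     \<and> (\<forall>u\<in>prob_simplex. u \<noteq> p \<longrightarrow> quad d u < quad d p)"

text \<open>
  The stationary values which a later check may still observe. After the first inner step
  \<open>quad d p\<close> exceeds the value of the last check, but \<open>p\<close> may already be the target \<open>y\<close>;
  hence the case distinction on \<open>s\<close>.
\<close>

fun level :: "'n peel_state \<Rightarrow> real set" where
  "level (PhaseI J p) = range (\<lambda>J. quad d (pvec d J))"
| "level (Check p g c k) = {v \<in> range (\<lambda>J. quad d (pvec d J)). c < v}"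
| "level (Inner p J y s) =
     {v \<in> range (\<lambda>J. quad d (pvec d J)). quad d p < v \<or> quad d p = v \<and> s \<noteq> 1}"
| "level (Return p) = {}"

text \<open>At a check the rank exceeds the size of every working set, so entering Phase III lowers
  it.\<close>

fun rank :: "'n peel_state \<Rightarrow> nat" where
  "rank (PhaseI J p) = card J"
| "rank (Check p g c k) = CARD('n) + 1"
| "rank (Inner p J y s) = card J"
| "rank (Return p) = 0"

fun is_check :: "'n peel_state \<Rightarrow> bool" where
  "is_check (Check p g c k) = True"
| "is_check _ = False"

lemma finite_level: "finite (level S)"
  by (cases S) auto

text \<open>Only transitions into a check must lose a level; the others may keep all levels if the
  rank drops.\<close>

definition descends :: "'n peel_state \<Rightarrow> 'n peel_state \<Rightarrow> bool" where
  "descends S S' \<longleftrightarrow> inv_state S' \<and> level S' \<subseteq> level S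
     \<and> (if is_check S' then level S' \<noteq> level S else rank S' < rank S)"

section \<open>Each transition preserves the invariant and descends\<close>

lemma descends_phaseI_loop:
  assumes "inv_state (PhaseI J p)" "(MIN j. p $ j) < 0"
  shows "descends (PhaseI J p) (PhaseI {j. p $ j > 0} (pvec d {j. p $ j > 0}))"
proof -
  have J: "2 \<le> card J" and p: "p = pvec d J" using assms by auto
  obtain i where i: "p $ i < 0" using assms(2) by (auto simp: Min_less_iff)
  have outside: "p $ j = 0" if "j \<notin> J" for j using pvec_outside[OF that] p by simp
  then have "{j. p $ j > 0} \<subseteq> J" by force
  moreover have "i \<in> J" "i \<notin> {j. p $ j > 0}" using i outside by force+
  ultimately have "{j. p $ j > 0} \<subset> J" by blast
  then have "card {j. p $ j > 0} < card J" by (intro psubset_card_mono) auto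
  then show ?thesis using card_pos_pvec[OF J] p by (simp add: descends_def)
qed

lemma inv_check:
  assumes "2 \<le> card J" "p = pvec d J" "\<And>j. 0 \<le> p $ j"
    and "g = d *v p" "c = p \<bullet> g" "is_arg_max (\<lambda>j. g $ j) (\<lambda>_. True) k"
  shows "inv_state (Check p g c k)"
  using assms sum_pvec[OF assms(1)]
  by (auto simp: quad_def is_arg_max_def not_less intro!: prob_simplexI)

lemma descends_phaseI_exit:
  assumes "inv_state (PhaseI J p)" "\<not> (MIN j. p $ j) < 0"
    and "g = d *v p" "c = p \<bullet> g" "is_arg_max (\<lambda>j. g $ j) (\<lambda>_. True) k"
  shows "descends (PhaseI J p) (Check p g c k)"
proof -
  have "0 \<le> p $ j" for j using assms(2) by (auto simp: Min_less_iff not_less)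
  then have "inv_state (Check p g c k)" using assms by (intro inv_check) auto
  \<comment> \<open>\<open>c\<close> is a level of Phase I but not of the check, whose levels lie
    strictly above \<open>c\<close>.\<close>
  moreover have "c \<in> range (\<lambda>J. quad d (pvec d J))" using assms by (auto simp: quad_def)
  ultimately show ?thesis by (auto simp: descends_def)
qed

lemma descends_return:
  assumes "inv_state (Check p g c k)" "\<not> g $ k > c"
  shows "descends (Check p g c k) (Return p)"
proof -
  have "(d *v p) $ j \<le> quad d p" for j using assms by (auto intro: order_trans simp: not_less)
  then show ?thesis using assms simplex_maximizer[of p] by (auto simp: descends_def)
qed

lemma descends_enter:
  assumes "inv_state (Check p g c k)" "g $ k > c"
  shows "descends (Check p g c k) (Inner p (supp p \<union> {k}) (pvec d (supp p \<union> {k})) 1)"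
proof -
  obtain J where J: "2 \<le> card J" "p = pvec d J" using assms by auto
  define K where "K = supp p \<union> {k}"
  have p: "p \<in> prob_simplex" and k: "(d *v p) $ k > quad d p" using assms by auto
  have one: "1 \<bullet> p = 1" using p by (simp add: prob_simplex_def)
  have pos: "0 < quad d p" using quad_pvec_pos J by simp
  have "card (supp p) \<le> card K" by (intro card_mono) (auto simp: K_def)
  then have K: "2 \<le> card K" using quad_nonzero_card[of p] pos by linarith
  have yk: "pvec d K $ k > 0" "p $ k = 0"
    using entering_coordinate_pos[OF J k] K by (auto simp: K_def)
  then have "p \<noteq> pvec d K" by auto
  then have "quad d p < quad d (pvec d K)"
    using K one by (intro quad_pvec_max(2)) (auto simp: K_def)
  \<comment> \<open>The only index of \<open>K\<close> outside the support of \<open>p\<close> is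
    \<open>k\<close>, where the target is positive.\<close>
  moreover have "0 < p $ i" if "pvec d K $ i < 0" for i
  proof -
    have "i \<in> K" "i \<noteq> k" using that yk pvec_outside[of i K] by auto
    then have "p $ i \<noteq> 0" "0 \<le> p $ i" using p by (auto simp: K_def supp_def prob_simplex_def)
    then show ?thesis by simp
  qed
  moreover have "card K \<le> CARD('n)" by (intro card_mono) auto
  ultimately show ?thesis
    using p pos K assms(1) unfolding K_def[symmetric] by (auto simp: descends_def K_def)
qed

lemma descends_inner_loop:
  assumes "inv_state (Inner p J y s)" "(MIN j\<in>J. y $ j) < 0"
    and t: "t = Min {p $ i / (p $ i - y $ i) | i. y $ i < 0}"
    and p': "p' = p + t *\<^sub>R (y - p)" and J': "J' = {j. p' $ j > 0}"
  shows "descends (Inner p J y s) (Inner p' J' (pvec d J') (Suc s))"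
proof -
  have J: "2 \<le> card J" and y: "y = pvec d J" and p: "p \<in> prob_simplex" and supp: "supp p \<subseteq> J"
    and pos: "\<And>i. y $ i < 0 \<Longrightarrow> 0 < p $ i" and q: "0 < quad d p" and s: "1 \<le> s"
    and count: "card J + s \<le> CARD('n) + 1"
    using assms(1) by auto
  have p0: "0 \<le> p $ i" for i using p by (simp add: prob_simplex_def)
  have one: "1 \<bullet> p = 1" "1 \<bullet> y = 1" using p sum_pvec[OF J] y by (auto simp: prob_simplex_def)
  have "J \<noteq> {}" using J by auto
  then obtain m where m: "y $ m < 0" using assms(2) by (auto simp: Min_less_iff)
  let ?T = "{p $ i / (p $ i - y $ i) | i. y $ i < 0}"
  have fin: "finite ?T" "?T \<noteq> {}" using m by auto
  \<comment> \<open>\<open>l\<close> is a blocking coordinate: it reaches 0 at step length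
    \<open>t\<close> and leaves the working set.\<close>
  from Min_in[OF fin] obtain l where l: "y $ l < 0" "t = p $ l / (p $ l - y $ l)"
    unfolding t by blast
  have t01: "0 < t" "t < 1" using l(1) pos[OF l(1)] by (simp_all add: l(2))
  have comb: "p' $ i = (1 - t) * p $ i + t * y $ i" for i
    by (simp add: p' algebra_simps)
  have nonneg: "0 \<le> p' $ i" for i
  proof (cases "y $ i < 0")
    case True
    then have "t \<le> p $ i / (p $ i - y $ i)" unfolding t using fin by (intro Min_le) auto
    then show ?thesis using True pos[OF True] by (simp add: comb field_simps)
  next
    case False
    then show ?thesis using t01 p0[of i] by (simp add: comb)
  qed
  have "p' $ l = 0" using l pos[of l] by (simp add: comb field_simps)
  have "1 \<bullet> p' = 1" using one by (simp add: p' inner_add_right inner_diff_right)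
  then have simplex: "p' \<in> prob_simplex" using nonneg by (intro prob_simplexI)
  have supp': "supp p' = J'" using nonneg by (auto simp: supp_def J' less_le)
  have "p' $ i = 0" if "i \<notin> J" for i
    using that supp pvec_outside[OF that] by (auto simp: comb y supp_def)
  then have sub: "J' \<subseteq> J" unfolding J' by force
  moreover have "l \<in> J" using l(1) pvec_outside[of l J] y by auto
  moreover have "l \<notin> J'" using \<open>p' $ l = 0\<close> J' by simp
  ultimately have less: "card J' < card J" by (intro psubset_card_mono) auto
  \<comment> \<open>The step scales \<open>p - y\<close> by \<open>1 - t\<close>, hence the gap
    below \<open>quad d y\<close> by the square of that factor, which is less than 1.\<close>
  have "p \<noteq> y" using m p0[of m] by auto
  then have "quad d (p - y) < 0" using one by (intro quad_neg) (auto simp: inner_diff_right)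
  moreover have "(1 - t)\<^sup>2 < 1" using t01 by (simp add: power_less_one_iff)
  ultimately have "quad d (p - y) < (1 - t)\<^sup>2 * quad d (p - y)" by simp
  also have "\<dots> = quad d (p' - y)"
  proof -
    have "p' - y = (1 - t) *\<^sub>R (p - y)" by (simp add: p' algebra_simps)
    then show ?thesis by (simp only: quad_scaleR)
  qed
  finally have inc: "quad d p < quad d p'"
    using quad_pvec_expand[OF J supp one(1)] quad_pvec_expand[OF J _ \<open>1 \<bullet> p' = 1\<close>] supp' sub y
    by simp
  then have "2 \<le> card J'" using quad_nonzero_card[of p'] q supp' by simp
  moreover have "0 < p' $ i" if "pvec d J' $ i < 0" for i
    using that pvec_outside[of i J'] J' by force
  ultimately show ?thesis
    using simplex supp' less inc q s count by (auto simp: descends_def)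
qed

text \<open>\<open>c\<close> itself is the lost level: maximality of \<open>y\<close> puts it among
  the levels of the inner state, with strictness from the invariant if \<open>s = 1\<close>.\<close>

lemma descends_inner_exit:
  assumes "inv_state (Inner p J y s)" "\<not> (MIN j\<in>J. y $ j) < 0"
    and "g = d *v y" "c = y \<bullet> g" "is_arg_max (\<lambda>j. g $ j) (\<lambda>_. True) k"
  shows "descends (Inner p J y s) (Check y g c k)"
proof -
  have J: "2 \<le> card J" and y: "y = pvec d J" and p: "p \<in> prob_simplex" and supp: "supp p \<subseteq> J"
    using assms(1) by auto
  have "J \<noteq> {}" using J by auto
  then have "0 \<le> y $ j" for j
    using assms(2) pvec_outside[of j J] y by (cases "j \<in> J") (auto simp: Min_less_iff not_less)
  then have "inv_state (Check y g c k)" using assms J y by (intro inv_check) auto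
  moreover have c: "c = quad d (pvec d J)" using assms y by (simp add: quad_def)
  moreover have "quad d p \<le> c"
    using quad_pvec_max(1)[OF J supp] p c by (simp add: prob_simplex_def)
  moreover have "s = 1 \<Longrightarrow> quad d p < c" using assms(1) c y by simp
  ultimately have "inv_state (Check y g c k)" "level (Check y g c k) \<subseteq> level (Inner p J y s)"
    "c \<in> level (Inner p J y s)"
    by auto
  moreover have "c \<notin> level (Check y g c k)" by simp
  ultimately show ?thesis unfolding descends_def by auto
qed

lemma step_descends:
  assumes "peel_step d S S'" "inv_state S"
  shows "descends S S'"
  using assms
proof (cases rule: peel_step.cases)
  case phaseI_loop
  then show ?thesis using assms descends_phaseI_loop by blast
next
  case phaseI_exit
  then show ?thesis using assms descends_phaseI_exit by blast
next
  case check_return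
  then show ?thesis using assms descends_return by blast
next
  case check_enter
  then show ?thesis using assms descends_enter by blast
next
  case inner_loop
  then show ?thesis using assms descends_inner_loop by blast
next
  case inner_exit
  then show ?thesis using assms descends_inner_exit by blast
qed

section \<open>Termination and increase between checks\<close>

definition step_order :: "('n peel_state \<times> 'n peel_state) set" where
  "step_order = measures [\<lambda>S. card (level S), rank]"

lemma wf_step_order: "wf step_order"
  by (simp add: step_order_def)

lemma descends_step_order:
  assumes "descends S S'"
  shows "(S', S) \<in> step_order"
proof -
  have "level S' = level S \<or> card (level S') < card (level S)"
    using assms psubset_card_mono[OF finite_level[of S], of "level S'"]
    by (auto simp: descends_def)
  then show ?thesis using assms psubset_card_mono[OF finite_level[of S], of "level S'"]
    by (auto simp: descends_def step_order_def split: if_splits)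
qed

text \<open>Inclusions accumulate along the run, and the last step into a check makes the inclusion
  proper.\<close>

lemma level_trancl:
  assumes "(peel_step d)\<^sup>+\<^sup>+ S S'" "inv_state S"
  shows "inv_state S' \<and> level S' \<subseteq> level S \<and> (is_check S' \<longrightarrow> level S' \<noteq> level S)"
  using assms
proof (induction rule: tranclp_induct)
  case (base S')
  then show ?case using step_descends by (force simp: descends_def)
next
  case (step S' S'')
  then have "descends S' S''" using step_descends by blast
  then show ?case using step by (auto simp: descends_def split: if_splits)
qed

text \<open>The levels of a check are those above its value, so \<open>c' \<le> c\<close> would
  reverse a proper inclusion.\<close>

lemma check_increase:
  assumes "inv_state (Check p g c k)"
    and "(peel_step d)\<^sup>+\<^sup>+ (Check p g c k) (Check p' g' c' k')"
  shows "c < c'"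
proof (rule ccontr)
  assume "\<not> c < c'"
  then have "level (Check p g c k) \<subseteq> level (Check p' g' c' k')" by auto
  then show False using level_trancl[OF assms(2,1)] by simp
qed

text \<open>The guards are complementary and an \<open>arg max\<close> exists, so no other state is
  stuck.\<close>

lemma step_exists:
  assumes "\<nexists>S'. peel_step d S S'"
  shows "\<exists>p. S = Return p"
proof (cases S)
  case (PhaseI J p)
  obtain k where "is_arg_max (\<lambda>j. (d *v p) $ j) (\<lambda>_. True) k" using arg_max_exists by blast
  then show ?thesis
    using assms phaseI_loop[OF _ refl, of p d J] phaseI_exit[OF _ refl refl, of p d k J] PhaseI
    by blast
next
  case (Check p g c k)
  then show ?thesis
    using assms check_return[of c g k d p] check_enter[OF _ refl, of c g k d p] by blast
next
  case (Inner p J y s)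
  obtain k where "is_arg_max (\<lambda>j. (d *v y) $ j) (\<lambda>_. True) k" using arg_max_exists by blast
  then show ?thesis
    using assms inner_loop[OF _ refl refl refl, of y J d p s] inner_exit[OF _ refl refl, of y J d k p s]
      Inner
    by blast
qed simp

context
  assumes card_ge_2: "2 \<le> CARD('n)"
begin

lemma reachable_inv: "peel_reachable d S \<Longrightarrow> inv_state S"
  unfolding peel_reachable_def
proof (induction rule: rtranclp_induct)
  case base
  then show ?case using card_ge_2 by (simp add: peel_init_def)
next
  case (step S S')
  then show ?case using step_descends by (auto simp: descends_def)
qed

lemma terminates: "peel_terminates d"
  unfolding peel_terminates_def
proof
  assume "\<exists>S. S 0 = peel_init d \<and> (\<forall>i. peel_step d (S i) (S (Suc i)))"
  then obtain S where S: "S 0 = peel_init d" "\<And>i. peel_step d (S i) (S (Suc i))" by blast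
  have "peel_reachable d (S i)" for i
    by (induction i) (auto simp: peel_reachable_def S intro: rtranclp.rtrancl_into_rtrancl)
  then have "(S (Suc i), S i) \<in> step_order" for i
    using S(2) reachable_inv step_descends descends_step_order by blast
  then show False using wf_step_order by (auto simp: wf_iff_no_infinite_down_chain)
qed

text \<open>A reachable state minimal for \<open>step_order\<close> has no successor.\<close>

lemma reachable_return: "\<exists>p. peel_reachable d (Return p)"
proof -
  have "peel_init d \<in> Collect (peel_reachable d)" by (simp add: peel_reachable_def)
  then obtain S where S: "peel_reachable d S"
    and min: "\<And>S'. (S', S) \<in> step_order \<Longrightarrow> \<not> peel_reachable d S'"
    using wfE_min[OF wf_step_order] by (metis mem_Collect_eq)
  have "\<nexists>S'. peel_step d S S'"
  proof
    assume "\<exists>S'. peel_step d S S'"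
    then obtain S' where "peel_step d S S'" by blast
    moreover from this have "peel_reachable d S'"
      using S unfolding peel_reachable_def by (rule rtranclp.rtrancl_into_rtrancl[rotated])
    ultimately show False
      using min descends_step_order step_descends reachable_inv[OF S] by blast
  qed
  then show ?thesis using step_exists S by blast
qed

end

end

theorem theorem5:
  fixes d :: "real^'n^'n"
  assumes "CARD('n) \<ge> 2"
    and "transpose d = d"
    and "\<And>i. d $ i $ i = 0"
    and "\<And>i j. i \<noteq> j \<Longrightarrow> d $ i $ j > 0"
    and "strict_negative_type d"
  shows "\<exists>pstar.
      (\<forall>p. is_arg_max (quad d) (\<lambda>p. p \<in> prob_simplex) p \<longleftrightarrow> p = pstar)
    \<and> peel_terminates d
    \<and> (\<forall>S. peel_reachable d S \<and> (\<nexists>S'. peel_step d S S') \<longrightarrow> S = Return pstar)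
    \<and> (\<forall>J p. peel_reachable d (PhaseI J p) \<longrightarrow> card J \<ge> 2)
    \<and> (\<forall>p J y s. peel_reachable d (Inner p J y s) \<longrightarrow> card J \<ge> 2)
    \<and> (\<forall>p g c k. peel_reachable d (Check p g c k) \<longrightarrow> p \<in> prob_simplex)
    \<and> (\<forall>p J y s. peel_reachable d (Inner p J y s) \<longrightarrow> p \<in> prob_simplex)
    \<and> (\<forall>p. peel_reachable d (Return p) \<longrightarrow> p \<in> prob_simplex)
    \<and> (\<forall>p J y s. peel_reachable d (Inner p J y s) \<longrightarrow> s \<le> CARD('n) - 1)
    \<and> (\<forall>p g c k. peel_reachable d (Check p g c k) \<longrightarrow> c = quad d p)
    \<and> (\<forall>p g c k p' g' c' k'. peel_reachable d (Check p g c k)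
          \<and> (peel_step d)\<^sup>+\<^sup>+ (Check p g c k) (Check p' g' c' k') \<longrightarrow> c < c')"
proof -
  interpret distance_matrix d by standard (fact assms)+
  note inv = reachable_inv[OF assms(1)]
  \<comment> \<open>Existence of the maximizer comes from a run of the algorithm instead of
    compactness: the invariant at \<open>Return\<close> is strict optimality.\<close>
  obtain pstar where "peel_reachable d (Return pstar)" using reachable_return[OF assms(1)] by blast
  then have simplex: "pstar \<in> prob_simplex"
    and max: "\<And>u. u \<in> prob_simplex \<Longrightarrow> u \<noteq> pstar \<Longrightarrow> quad d u < quad d pstar"
    using inv by fastforce+
  have unique: "p = pstar" if "peel_reachable d (Return p)" for p
  proof (rule ccontr)
    assume "p \<noteq> pstar"
    then show False using inv[OF that] simplex max[of p] by fastforce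
  qed
  show ?thesis
  proof (intro exI[of _ pstar] conjI allI impI)
    show "is_arg_max (quad d) (\<lambda>p. p \<in> prob_simplex) p \<longleftrightarrow> p = pstar" for p
      using simplex max unfolding is_arg_max_def by (metis less_asym less_irrefl)
    show "peel_terminates d" by (rule terminates[OF assms(1)])
    show "S = Return pstar" if "peel_reachable d S \<and> (\<nexists>S'. peel_step d S S')" for S
      using that step_exists unique by blast
    \<comment> \<open>Combine \<open>card J + s \<le> CARD('n) + 1\<close> with
      \<open>2 \<le> card J\<close>.\<close>
    show "s \<le> CARD('n) - 1" if "peel_reachable d (Inner p J y s)" for p J y s
      using inv[OF that] by auto
    show "c < c'" if "peel_reachable d (Check p g c k)
        \<and> (peel_step d)\<^sup>+\<^sup>+ (Check p g c k) (Check p' g' c' k')" for p g c k p' g' c' k'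
      using that inv check_increase by blast
    show "2 \<le> card J" if "peel_reachable d (PhaseI J p)" for J p using inv[OF that] by simp
    show "2 \<le> card J" if "peel_reachable d (Inner p J y s)" for p J y s using inv[OF that] by simp
    show "p \<in> prob_simplex" if "peel_reachable d (Check p g c k)" for p g c k
      using inv[OF that] by simp
    show "p \<in> prob_simplex" if "peel_reachable d (Inner p J y s)" for p J y s
      using inv[OF that] by simp
    show "p \<in> prob_simplex" if "peel_reachable d (Return p)" for p using inv[OF that] by simp
    show "c = quad d p" if "peel_reachable d (Check p g c k)" for p g c k
      using inv[OF that] by simp
  qed
qed

end
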